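(* Let $n\ge1$, $I=[0,1]$, and let $(\mu_{\mathbf k})_{\mathbf k\in\mathbb N_0^n}$ be a multi-index sequence of real numbers that solves the classical (multivariate) Hausdorff problem of moments, i.e. there exists a (possibly signed) Radon measure $\nu$ on $I^n$ such that $$\mu_{\mathbf k}=\int_{I^n}t_1^{k_1}\cdots t_n^{k_n}\,\nu(dt_1,\dots,dt_n)\qquad\text{for all }\mathbf k=(k_1,\dots,k_n)\in\mathbb N_0^n.$$ Then $(\mu_{\mathbf k})$ solves the strong multilinear Hausdorff problem of moments, i.e. there exists a (possibly signed) Radon measure $\mu$ on $I$ such that $$L_\mu(p_1,\dots,p_n)=\int_0^1p_1(t)\cdots p_n(t)\,\mu(dt)\qquad\text{for all }p_1,\dots,p_n\in\mathbb R[t],$$ if and only if $(\mu_{\mathbf k})$ is Hänkel, i.e. $\mu_{\mathbf k+\mathbf 1_l}=\mu_{\mathbf k+\mathbf 1_{l+1}}$ for all $\mathbf k\in\mathbb N_0^n$ and all $l=1,\dots,n-1$.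
   Context: $\mathbb N_0=\{0,1,2,\dots\}$. $\mathbf 1_l\in\mathbb N_0^n$ is the multi-index with $(\mathbf 1_l)_j=\delta_{lj}$. $L_\mu$ denotes the $n$-linear functional on $\mathbb R[t]\times\cdots\times\mathbb R[t]$ ($n$ factors) determined by the sequence $(\mu_{\mathbf k})$ through $L_\mu(t^{k_1},\dots,t^{k_n})=\mu_{(k_1,\dots,k_n)}$ for all $(k_1,\dots,k_n)\in\mathbb N_0^n$. *)

theory Defs
  imports "HOL-Analysis.Analysis" "HOL-Computational_Algebra.Polynomial"
begin

section \<open>Signed Radon measures on a subset of a topological space\<close>

text \<open>
  A signed measure on the Borel sets of \<open>S\<close> is a real-valued set function; its values outside
  the Borel sets of \<open>S\<close> are irrelevant.
\<close>

definition signed_measure_on :: "'a::topological_space set \<Rightarrow> ('a set \<Rightarrow> real) \<Rightarrow> bool" where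
  "signed_measure_on S \<nu> \<longleftrightarrow>
     \<nu> {} = 0 \<and>
     (\<forall>A :: nat \<Rightarrow> 'a set. range A \<subseteq> sets (restrict_space borel S) \<longrightarrow> disjoint_family A \<longrightarrow>
        (\<lambda>i. \<nu> (A i)) sums \<nu> (\<Union>i. A i))"

text \<open>
  The positive part \<open>\<nu>\<^sup>+(E) = sup {\<nu>(F) | F \<subseteq> E Borel}\<close> of the Jordan decomposition. Negative values of
  \<open>\<nu> F\<close> are truncated to \<open>0\<close> by \<^const>\<open>ennreal\<close>, which does not affect the supremum, as
  \<open>\<nu> {} = 0\<close>.
\<close>

definition pos_variation :: "'a::topological_space set \<Rightarrow> ('a set \<Rightarrow> real) \<Rightarrow> 'a measure" where
  "pos_variation S \<nu> = measure_of S (sets (restrict_space borel S))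
     (\<lambda>E. SUP F \<in> {F \<in> sets (restrict_space borel S). F \<subseteq> E}. ennreal (\<nu> F))"

definition neg_variation :: "'a::topological_space set \<Rightarrow> ('a set \<Rightarrow> real) \<Rightarrow> 'a measure" where
  "neg_variation S \<nu> = pos_variation S (\<lambda>F. - \<nu> F)"

definition radon_measure_on :: "'a::t2_space set \<Rightarrow> 'a measure \<Rightarrow> bool" where
  "radon_measure_on S M \<longleftrightarrow>
     sets M = sets (restrict_space borel S) \<and>
     (\<forall>K. compact K \<and> K \<subseteq> S \<longrightarrow> emeasure M K < \<infinity>) \<and>
     (\<forall>B \<in> sets M. emeasure M B = (SUP K \<in> {K. compact K \<and> K \<subseteq> B}. emeasure M K))"

definition signed_radon_measure_on :: "'a::t2_space set \<Rightarrow> ('a set \<Rightarrow> real) \<Rightarrow> bool" where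
  "signed_radon_measure_on S \<nu> \<longleftrightarrow>
     signed_measure_on S \<nu> \<and>
     radon_measure_on S (pos_variation S \<nu>) \<and> radon_measure_on S (neg_variation S \<nu>)"

definition signed_integral ::
    "'a::topological_space set \<Rightarrow> ('a set \<Rightarrow> real) \<Rightarrow> ('a \<Rightarrow> real) \<Rightarrow> real" where
  "signed_integral S \<nu> f =
     integral\<^sup>L (pos_variation S \<nu>) f - integral\<^sup>L (neg_variation S \<nu>) f"


section \<open>Multi-indices and the multilinear functional of a multi-index sequence\<close>

text \<open>
  An \<open>n\<close>-tuple is a function on \<open>nat\<close> with relevant arguments \<open>1, \<dots>, n\<close>. For points of the cube and
  for multi-indices the remaining values are fixed to \<^const>\<open>undefined\<close>, so that these tuples
  correspond one-to-one to functions on \<open>{1..n}\<close>. The cube carries the subspace topology of the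
  product topology on \<^typ>\<open>nat \<Rightarrow> real\<close>, which is the usual topology of \<open>[0,1]\<^sup>n\<close>.
\<close>

definition multi_index :: "nat \<Rightarrow> (nat \<Rightarrow> nat) set" where
  "multi_index n = {1..n} \<rightarrow>\<^sub>E UNIV"

definition cube :: "nat \<Rightarrow> (nat \<Rightarrow> real) set" where
  "cube n = {1..n} \<rightarrow>\<^sub>E {0..1}"

text \<open>\<open>k + 1\<^sub>l\<close>\<close>

definition incr :: "nat \<Rightarrow> (nat \<Rightarrow> nat) \<Rightarrow> (nat \<Rightarrow> nat)" where
  "incr l k = k(l := k l + 1)"

definition hankel :: "nat \<Rightarrow> ((nat \<Rightarrow> nat) \<Rightarrow> real) \<Rightarrow> bool" where
  "hankel n \<mu> \<longleftrightarrow>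
     (\<forall>k \<in> multi_index n. \<forall>l \<in> {1..<n}. \<mu> (incr l k) = \<mu> (incr (l + 1) k))"

definition functional_of ::
    "nat \<Rightarrow> ((nat \<Rightarrow> nat) \<Rightarrow> real) \<Rightarrow> (nat \<Rightarrow> real poly) \<Rightarrow> real" where
  "functional_of n \<mu> p =
     (\<Sum>k \<in> Pi\<^sub>E {1..n} (\<lambda>i. {..degree (p i)}). (\<Prod>i = 1..n. coeff (p i) (k i)) * \<mu> k)"

text \<open>
  \<open>functional_of n \<mu>\<close> is the unique \<open>n\<close>-linear functional with value \<open>\<mu> k\<close> at
  \<open>(t\<^bsup>k 1\<^esup>, \<dots>, t\<^bsup>k n\<^esup>)\<close>; see lemma \<open>functional_of_unique\<close> below.
\<close>

definition n_linear :: "nat \<Rightarrow> ((nat \<Rightarrow> real poly) \<Rightarrow> real) \<Rightarrow> bool" where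
  "n_linear n F \<longleftrightarrow>
     (\<forall>p q. (\<forall>i \<in> {1..n}. p i = q i) \<longrightarrow> F p = F q) \<and>
     (\<forall>l \<in> {1..n}. \<forall>p a b q r.
        F (p(l := smult a q + smult b r)) = a * F (p(l := q)) + b * F (p(l := r)))"

lemma functional_of_bound:
  assumes "\<And>i. i \<in> {1..n} \<Longrightarrow> degree (p i) \<le> N"
  shows "functional_of n \<mu> p =
    (\<Sum>k \<in> {1..n} \<rightarrow>\<^sub>E {..N}. (\<Prod>i = 1..n. coeff (p i) (k i)) * \<mu> k)"
  unfolding functional_of_def
proof (rule sum.mono_neutral_left)
  show "finite ({1..n} \<rightarrow>\<^sub>E {..N})"
    by (intro finite_PiE) auto
  show "Pi\<^sub>E {1..n} (\<lambda>i. {..degree (p i)}) \<subseteq> {1..n} \<rightarrow>\<^sub>E {..N}"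
    by (rule PiE_mono) (use assms in auto)
  show "\<forall>k \<in> ({1..n} \<rightarrow>\<^sub>E {..N}) - Pi\<^sub>E {1..n} (\<lambda>i. {..degree (p i)}).
      (\<Prod>i = 1..n. coeff (p i) (k i)) * \<mu> k = 0"
  proof
    fix k assume k: "k \<in> ({1..n} \<rightarrow>\<^sub>E {..N}) - Pi\<^sub>E {1..n} (\<lambda>i. {..degree (p i)})"
    then obtain i where "i \<in> {1..n}" "\<not> k i \<le> degree (p i)"
      by (auto simp: PiE_iff)
    then have "\<exists>i \<in> {1..n}. coeff (p i) (k i) = 0"
      by (meson coeff_eq_0 not_le)
    then show "(\<Prod>i = 1..n. coeff (p i) (k i)) * \<mu> k = 0"
      by (simp add: prod_zero)
  qed
qed

lemma functional_of_n_linear: "n_linear n (functional_of n \<mu>)"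
  unfolding n_linear_def
proof (intro conjI allI impI ballI)
  fix p q :: "nat \<Rightarrow> real poly" assume eq: "\<forall>i \<in> {1..n}. p i = q i"
  then have "Pi\<^sub>E {1..n} (\<lambda>i. {..degree (p i)}) = Pi\<^sub>E {1..n} (\<lambda>i. {..degree (q i)})"
    by (intro PiE_cong) auto
  then show "functional_of n \<mu> p = functional_of n \<mu> q"
    unfolding functional_of_def using eq by (intro sum.cong) auto
next
  fix l and p :: "nat \<Rightarrow> real poly" and a b :: real and q r :: "real poly"
  assume l: "l \<in> {1..n}"
  define N where "N = degree q + degree r + degree (smult a q + smult b r) +
    (\<Sum>i = 1..n. degree (p i))"
  let ?I = "{1..n} \<rightarrow>\<^sub>E {..N}"
  have deg: "degree q \<le> N" "degree r \<le> N" "degree (smult a q + smult b r) \<le> N"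
    "\<And>i. i \<in> {1..n} \<Longrightarrow> degree (p i) \<le> N"
    unfolding N_def by (auto intro!: trans_le_add2 member_le_sum)
  have ex: "functional_of n \<mu> (p(l := s)) =
      (\<Sum>k \<in> ?I. coeff s (k l) * (\<Prod>i \<in> {1..n} - {l}. coeff (p i) (k i)) * \<mu> k)"
    if "degree s \<le> N" for s
  proof -
    have "(\<Prod>i = 1..n. coeff ((p(l := s)) i) (k i)) =
        coeff s (k l) * (\<Prod>i \<in> {1..n} - {l}. coeff (p i) (k i))" for k
      using l by (simp add: prod.remove[of _ l])
    moreover have "functional_of n \<mu> (p(l := s)) =
        (\<Sum>k \<in> ?I. (\<Prod>i = 1..n. coeff ((p(l := s)) i) (k i)) * \<mu> k)"
      by (rule functional_of_bound) (use deg that in auto)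
    ultimately show ?thesis by simp
  qed
  show "functional_of n \<mu> (p(l := smult a q + smult b r)) =
      a * functional_of n \<mu> (p(l := q)) + b * functional_of n \<mu> (p(l := r))"
    unfolding ex[OF deg(1)] ex[OF deg(2)] ex[OF deg(3)]
    by (simp add: sum_distrib_left flip: sum.distrib) (simp add: algebra_simps)
qed

lemma functional_of_monom:
  assumes "k \<in> multi_index n"
  shows "functional_of n \<mu> (\<lambda>i. monom 1 (k i)) = \<mu> k"
proof -
  let ?I = "Pi\<^sub>E {1..n} (\<lambda>i. {..degree (monom (1::real) (k i))})"
  have fin: "finite ?I" by (intro finite_PiE) auto
  have k: "k \<in> ?I" using assms by (auto simp: multi_index_def PiE_iff degree_monom_eq)
  have "(\<Prod>i = 1..n. coeff (monom (1::real) (k i)) (j i)) = (if j = k then 1 else 0)"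
    if j: "j \<in> ?I" for j
  proof (cases "j = k")
    case False
    then obtain i where "i \<in> {1..n}" "j i \<noteq> k i"
      using PiE_ext[OF j k] by blast
    then have "\<exists>i \<in> {1..n}. coeff (monom (1::real) (k i)) (j i) = 0"
      by (metis coeff_monom)
    with False show ?thesis by (simp add: prod_zero)
  qed simp
  then have "functional_of n \<mu> (\<lambda>i. monom 1 (k i)) = (\<Sum>j \<in> ?I. (if j = k then 1 else 0) * \<mu> j)"
    unfolding functional_of_def by (intro sum.cong) auto
  also have "\<dots> = (\<Sum>j \<in> ?I. if j = k then \<mu> j else 0)"
    by (intro sum.cong) auto
  also have "\<dots> = \<mu> k" using fin k by simp
  finally show ?thesis .
qed

lemma n_linear_sum:
  assumes "n_linear n F" "l \<in> {1..n}" "finite J"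
  shows "F (p(l := (\<Sum>j \<in> J. smult (c j) (q j)))) = (\<Sum>j \<in> J. c j * F (p(l := q j)))"
  using assms(3)
proof induction
  case empty
  have "F (p(l := smult 0 0 + smult 0 0)) = 0 * F (p(l := 0)) + 0 * F (p(l := 0))"
    using assms(1,2) unfolding n_linear_def by blast
  then show ?case by (simp add: fun_upd_def)
next
  case (insert x J)
  have "F (p(l := smult (c x) (q x) + smult 1 (\<Sum>j \<in> J. smult (c j) (q j)))) =
      c x * F (p(l := q x)) + 1 * F (p(l := (\<Sum>j \<in> J. smult (c j) (q j))))"
    using assms(1,2) unfolding n_linear_def by blast
  with insert show ?case by (simp add: fun_upd_def)
qed

lemma n_linear_expand:
  assumes F: "n_linear n F" and "finite A" "A \<subseteq> {1..n}"
  shows "F p = (\<Sum>k \<in> Pi\<^sub>E A (\<lambda>i. {..degree (p i)}).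
    (\<Prod>i \<in> A. coeff (p i) (k i)) * F (\<lambda>i. if i \<in> A then monom 1 (k i) else p i))"
  using assms(2,3)
proof (induction)
  case empty
  then show ?case by simp
next
  case (insert x A)
  let ?P = "Pi\<^sub>E A (\<lambda>i. {..degree (p i)})"
  let ?G = "\<lambda>k i. if i \<in> A then monom 1 (k i) else p i"
  let ?H = "\<lambda>k i. if i \<in> insert x A then monom 1 (k i) else p i"
  have step: "F (?G k) = (\<Sum>m \<le> degree (p x). coeff (p x) m * F (?H (k(x := m))))" for k
  proof -
    have "?G k = (?G k)(x := (\<Sum>m \<le> degree (p x). smult (coeff (p x) m) (monom 1 m)))"
      using insert.hyps poly_as_sum_of_monoms[of "p x"] by (auto simp: smult_monom fun_eq_iff)
    then have "F (?G k) = (\<Sum>m \<le> degree (p x). coeff (p x) m * F ((?G k)(x := monom 1 m)))"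
      using n_linear_sum[OF F, of x "{..degree (p x)}" "?G k" "\<lambda>m. coeff (p x) m" "monom 1"]
        insert.prems by simp
    moreover have "(?G k)(x := monom 1 m) = ?H (k(x := m))" for m
      using insert.hyps by (auto simp: fun_eq_iff)
    ultimately show ?thesis by simp
  qed
  have prod: "(\<Prod>i \<in> insert x A. coeff (p i) ((k(x := m)) i)) =
      coeff (p x) m * (\<Prod>i \<in> A. coeff (p i) (k i))" for k m
    using insert.hyps by (simp, intro disjI2 prod.cong) auto
  have "F p = (\<Sum>k \<in> ?P. (\<Prod>i \<in> A. coeff (p i) (k i)) * F (?G k))"
    using insert by simp
  also have "\<dots> = (\<Sum>k \<in> ?P. \<Sum>m \<le> degree (p x).
      (\<Prod>i \<in> insert x A. coeff (p i) ((k(x := m)) i)) * F (?H (k(x := m))))"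
    unfolding step prod by (simp add: sum_distrib_left mult_ac)
  also have "\<dots> = (\<Sum>m \<le> degree (p x). \<Sum>k \<in> ?P.
      (\<Prod>i \<in> insert x A. coeff (p i) ((k(x := m)) i)) * F (?H (k(x := m))))"
    by (rule sum.swap)
  also have "\<dots> = (\<Sum>(m, k) \<in> {..degree (p x)} \<times> ?P.
      (\<Prod>i \<in> insert x A. coeff (p i) ((k(x := m)) i)) * F (?H (k(x := m))))"
    by (rule sum.cartesian_product)
  also have "\<dots> = (\<Sum>k \<in> Pi\<^sub>E (insert x A) (\<lambda>i. {..degree (p i)}).
      (\<Prod>i \<in> insert x A. coeff (p i) (k i)) * F (?H k))"
    unfolding PiE_insert_eq
    by (subst sum.reindex[OF inj_combinator[OF insert.hyps(2)]])
       (simp add: case_prod_unfold comp_def)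
  finally show ?case .
qed

lemma functional_of_unique:
  "n_linear n F \<and> (\<forall>k \<in> multi_index n. F (\<lambda>i. monom 1 (k i)) = \<mu> k) \<longleftrightarrow> F = functional_of n \<mu>"
proof
  assume F: "n_linear n F \<and> (\<forall>k \<in> multi_index n. F (\<lambda>i. monom 1 (k i)) = \<mu> k)"
  show "F = functional_of n \<mu>"
  proof
    fix p
    have "F (\<lambda>i. if i \<in> {1..n} then monom 1 (k i) else p i) = \<mu> k"
      if "k \<in> Pi\<^sub>E {1..n} (\<lambda>i. {..degree (p i)})" for k
    proof -
      have "F (\<lambda>i. if i \<in> {1..n} then monom 1 (k i) else p i) = F (\<lambda>i. monom 1 (k i))"
        using F unfolding n_linear_def by (elim conjE allE impE) auto
      also have "\<dots> = \<mu> k"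
        using F that by (auto simp: multi_index_def PiE_iff)
      finally show ?thesis .
    qed
    then show "F p = functional_of n \<mu> p"
      using n_linear_expand[of n F "{1..n}" p] F by (simp add: functional_of_def)
  qed
next
  assume "F = functional_of n \<mu>"
  then show "n_linear n F \<and> (\<forall>k \<in> multi_index n. F (\<lambda>i. monom 1 (k i)) = \<mu> k)"
    by (simp add: functional_of_n_linear functional_of_monom)
qed


section \<open>The moment problems\<close>

definition solves_hausdorff :: "nat \<Rightarrow> ((nat \<Rightarrow> nat) \<Rightarrow> real) \<Rightarrow> bool" where
  "solves_hausdorff n \<mu> \<longleftrightarrow>
     (\<exists>\<nu>. signed_radon_measure_on (cube n) \<nu> \<and>
        (\<forall>k \<in> multi_index n.
           \<mu> k = signed_integral (cube n) \<nu> (\<lambda>t. \<Prod>i = 1..n. t i ^ k i)))"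

definition solves_strong_multilinear_hausdorff :: "nat \<Rightarrow> ((nat \<Rightarrow> nat) \<Rightarrow> real) \<Rightarrow> bool" where
  "solves_strong_multilinear_hausdorff n \<mu> \<longleftrightarrow>
     (\<exists>\<sigma>. signed_radon_measure_on {0..1::real} \<sigma> \<and>
        (\<forall>p :: nat \<Rightarrow> real poly.
           functional_of n \<mu> p = signed_integral {0..1} \<sigma> (\<lambda>t. \<Prod>i = 1..n. poly (p i) t)))"

end

theory Submission
  imports Defs
begin

text \<open>
  The moments of a measure on \<open>[0,1]\<close> depend only on \<open>k\<^sub>1 + \<dots> + k\<^sub>n\<close>, so they are Hankel. Conversely, a
  Hankel sequence depends only on this sum \<open>m\<close>, hence equals the moment \<open>\<integral> t\<^sub>1\<^sup>m d\<nu>\<close>, and the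
  push-forward of \<open>\<nu>\<close> under \<open>t \<mapsto> t\<^sub>1\<close> represents the multilinear functional. The positive variation of
  a push-forward is in general smaller than the push-forward of the positive variation; integrals
  still agree because the integral depends only on the difference of the two parts. No Hahn
  decomposition is needed: once the variations are known to be finite, \<open>\<nu> = \<nu>\<^sup>+ - \<nu>\<^sup>-\<close> follows
  directly from the supremum formula, and finiteness is part of the Radon property on a compact set.
\<close>

section \<open>Jordan decomposition\<close>

lemma signed_measure_on_empty: "signed_measure_on S \<nu> \<Longrightarrow> \<nu> {} = 0"
  by (simp add: signed_measure_on_def)

lemma signed_measure_on_sums:
  assumes "signed_measure_on S \<nu>" "range A \<subseteq> sets (restrict_space borel S)" "disjoint_family A"
  shows "(\<lambda>i. \<nu> (A i)) sums \<nu> (\<Union>i. A i)"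
  using assms by (auto simp: signed_measure_on_def)

lemma signed_measure_on_Un:
  assumes "signed_measure_on S \<nu>" "A \<in> sets (restrict_space borel S)"
    "B \<in> sets (restrict_space borel S)" "A \<inter> B = {}"
  shows "\<nu> (A \<union> B) = \<nu> A + \<nu> B"
proof -
  have "(\<lambda>i. \<nu> (binaryset A B i)) sums \<nu> (\<Union>i. binaryset A B i)"
    using assms by (intro signed_measure_on_sums)
      (auto simp: range_binaryset_eq disjoint_family_on_def binaryset_def)
  moreover have "(\<lambda>i. \<nu> (binaryset A B i)) sums (\<nu> A + \<nu> B)"
    using signed_measure_on_empty[OF assms(1)] by (rule binaryset_sums)
  ultimately show ?thesis
    by (metis sums_unique2 UN_binaryset_eq)
qed

lemma signed_measure_on_uminus:
  assumes "signed_measure_on S \<nu>"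
  shows "signed_measure_on S (\<lambda>A. - \<nu> A)"
  using assms unfolding signed_measure_on_def by (auto intro: sums_minus)

lemma sets_pos_variation [simp]: "sets (pos_variation S \<nu>) = sets (restrict_space borel S)"
proof -
  have "space (restrict_space borel S) = S" by (simp add: space_restrict_space)
  then show ?thesis
    unfolding pos_variation_def by (metis sets.sets_measure_of_eq)
qed

lemma sets_neg_variation [simp]: "sets (neg_variation S \<nu>) = sets (restrict_space borel S)"
  by (simp add: neg_variation_def)

lemma space_pos_variation [simp]: "space (pos_variation S \<nu>) = S"
  using sets_eq_imp_space_eq[OF sets_pos_variation[of S \<nu>]] by (simp add: space_restrict_space)

lemma space_neg_variation [simp]: "space (neg_variation S \<nu>) = S"
  by (simp add: neg_variation_def)

text \<open>\<open>ennreal\<close> truncates negative terms to \<open>0\<close>, so the right side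
  sums the positive parts of \<open>f\<close>. If that sum is finite, comparing \<open>f\<close>
  termwise with the positive parts gives the bound.\<close>

lemma ennreal_sums_le_suminf:
  fixes f :: "nat \<Rightarrow> real"
  assumes "f sums s"
  shows "ennreal s \<le> (\<Sum>i. ennreal (f i))"
proof (cases "(\<Sum>i. ennreal (f i)) = top")
  case False
  define g where "g = (\<lambda>i. max 0 (f i))"
  have eq: "(\<Sum>i. ennreal (f i)) = (\<Sum>i. ennreal (g i))"
    by (intro suminf_cong) (auto simp: g_def max_def ennreal_neg)
  have g: "\<And>i. 0 \<le> g i" by (simp add: g_def)
  have sm: "summable g"
    by (rule summable_suminf_not_top) (use g False eq in auto)
  have "s \<le> (\<Sum>i. g i)"
    by (rule sums_le[OF _ assms summable_sums[OF sm]]) (simp add: g_def)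
  then have "ennreal s \<le> ennreal (\<Sum>i. g i)" by (rule ennreal_leI)
  also have "\<dots> = (\<Sum>i. ennreal (g i))" using suminf_ennreal2[OF g sm] by simp
  finally show ?thesis using eq by simp
qed simp

text \<open>\<open>measure_of\<close> yields the zero measure unless the given set function is
  countably additive, so the supremum formula must be shown to be a measure before it can be used.
  Superadditivity comes from uniting competitors, countable subadditivity from cutting one
  up.\<close>

lemma emeasure_pos_variation:
  fixes S :: "'a::topological_space set"
  assumes \<nu>: "signed_measure_on S \<nu>" and E: "E \<in> sets (restrict_space borel S)"
  shows "emeasure (pos_variation S \<nu>) E =
    (SUP F \<in> {F \<in> sets (restrict_space borel S). F \<subseteq> E}. ennreal (\<nu> F))"
proof -
  let ?M = "sets (restrict_space borel S)"
  define P where "P E = (SUP F \<in> {F \<in> ?M. F \<subseteq> E}. ennreal (\<nu> F))" for E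
  have mono: "P A \<le> P B" if "A \<subseteq> B" for A B
    unfolding P_def using that by (intro SUP_subset_mono) auto
  have P_ge: "ennreal (\<nu> F) \<le> P A" if "F \<in> ?M" "F \<subseteq> A" for F A
    unfolding P_def using that by (intro SUP_upper) auto
  have super: "P A + P B \<le> P (A \<union> B)" if disj: "A \<inter> B = {}" for A B
  proof -
    have le: "ennreal (\<nu> F) + ennreal (\<nu> G) \<le> P (A \<union> B)"
      if "F \<in> ?M" "F \<subseteq> A" "G \<in> ?M" "G \<subseteq> B" for F G
    proof -
      \<comment> \<open>\<open>ennreal\<close> is additive on nonnegative reals only. If one of the
        values is at most \<open>0\<close>, its term vanishes and the other set alone is a
        competitor; otherwise \<open>F \<union> G\<close> is one.\<close>
      consider "\<nu> F \<le> 0" | "\<nu> G \<le> 0" | "0 \<le> \<nu> F" "0 \<le> \<nu> G" by linarith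
      then show ?thesis
      proof cases
        case 1
        then show ?thesis using that P_ge[of G "A \<union> B"] by (simp add: ennreal_neg le_supI2)
      next
        case 2
        then show ?thesis using that P_ge[of F "A \<union> B"] by (simp add: ennreal_neg le_supI1)
      next
        case 3
        have "F \<inter> G = {}" using that disj by blast
        then have "\<nu> (F \<union> G) = \<nu> F + \<nu> G"
          using signed_measure_on_Un[OF \<nu>] that by blast
        then have "ennreal (\<nu> F) + ennreal (\<nu> G) = ennreal (\<nu> (F \<union> G))"
          using 3 by simp
        also have "\<dots> \<le> P (A \<union> B)" using that by (intro P_ge) auto
        finally show ?thesis .
      qed
    qed
    have ne: "{F \<in> ?M. F \<subseteq> X} \<noteq> {}" for X by blast
    show ?thesis
      unfolding P_def[of A] P_def[of B] ennreal_SUP_add_left[OF ne, symmetric]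
    proof (rule SUP_least)
      fix F assume "F \<in> {F \<in> ?M. F \<subseteq> A}"
      then show "ennreal (\<nu> F) + (SUP G \<in> {G \<in> ?M. G \<subseteq> B}. ennreal (\<nu> G)) \<le> P (A \<union> B)"
        unfolding ennreal_SUP_add_right[OF ne] using le by (intro SUP_least) auto
    qed
  qed
  have "emeasure (pos_variation S \<nu>) E = P E"
  proof (rule emeasure_measure_of)
    show "pos_variation S \<nu> = measure_of S ?M P"
      unfolding pos_variation_def P_def[abs_def] ..
    show "?M \<subseteq> Pow S"
      using sets.space_closed[of "restrict_space borel S"] by (simp add: space_restrict_space)
    have "P {} = 0"
      using signed_measure_on_empty[OF \<nu>] by (simp add: P_def conj_commute cong: conj_cong)
    then show "positive (sets (pos_variation S \<nu>)) P" by (simp add: positive_def)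
    show "countably_additive (sets (pos_variation S \<nu>)) P"
    proof (rule countably_additiveI)
      fix A :: "nat \<Rightarrow> 'a set"
      assume A: "range A \<subseteq> sets (pos_variation S \<nu>)" "disjoint_family A"
      \<comment> \<open>Finite superadditivity bounds every partial sum, and monotonicity replaces
        the finite union by the full one.\<close>
      have "(\<Sum>i. P (A i)) \<le> P (\<Union>i. A i)"
      proof (rule suminf_le_const)
        fix n
        have "(\<Sum>i<n. P (A i)) \<le> P (\<Union>i<n. A i)"
        proof (induction n)
          case 0
          then show ?case by simp
        next
          case (Suc n)
          have "A i \<inter> A n = {}" if "i < n" for i
            using disjoint_family_onD[OF A(2), of i n] that by simp
          then have disj: "(\<Union>i<n. A i) \<inter> A n = {}" by blast
          have "(\<Sum>i<Suc n. P (A i)) \<le> P (\<Union>i<n. A i) + P (A n)"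
            using Suc by (simp add: add_right_mono)
          also have "\<dots> \<le> P ((\<Union>i<n. A i) \<union> A n)" by (rule super[OF disj])
          finally show ?case by (simp add: lessThan_Suc Un_commute)
        qed
        also have "\<dots> \<le> P (\<Union>i. A i)" by (intro mono) auto
        finally show "(\<Sum>i<n. P (A i)) \<le> P (\<Union>i. A i)" .
      qed simp
      \<comment> \<open>A competitor \<open>F\<close> for the union splits into the pieces
        \<open>F \<inter> A i\<close>, each a competitor for \<open>A i\<close>.\<close>
      moreover have "P (\<Union>i. A i) \<le> (\<Sum>i. P (A i))"
        unfolding P_def[of "\<Union>i. A i"]
      proof (rule SUP_least, clarify)
        fix F assume F: "F \<in> ?M" "F \<subseteq> (\<Union>i. A i)"
        have FA: "F \<inter> A i \<in> ?M" for i using F A by (auto intro!: sets.Int)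
        have "(\<lambda>i. \<nu> (F \<inter> A i)) sums \<nu> (\<Union>i. F \<inter> A i)"
          using FA A(2) by (intro signed_measure_on_sums[OF \<nu>])
            (auto simp: disjoint_family_on_def)
        moreover have "(\<Union>i. F \<inter> A i) = F" using F by blast
        ultimately have "ennreal (\<nu> F) \<le> (\<Sum>i. ennreal (\<nu> (F \<inter> A i)))"
          using ennreal_sums_le_suminf by metis
        also have "\<dots> \<le> (\<Sum>i. P (A i))"
          using FA by (intro suminf_le P_ge) auto
        finally show "ennreal (\<nu> F) \<le> (\<Sum>i. P (A i))" .
      qed
      ultimately show "(\<Sum>i. P (A i)) = P (\<Union>i. A i)" by (rule antisym)
    qed
    show "E \<in> sets (pos_variation S \<nu>)" using E by simp
  qed
  then show ?thesis by (simp add: P_def)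
qed

lemma pos_variation_ge:
  assumes "signed_measure_on S \<nu>" "E \<in> sets (restrict_space borel S)"
  shows "ennreal (\<nu> E) \<le> emeasure (pos_variation S \<nu>) E"
  using assms by (auto simp: emeasure_pos_variation intro: SUP_upper)

lemma neg_variation_ge:
  assumes "signed_measure_on S \<nu>" "E \<in> sets (restrict_space borel S)"
  shows "ennreal (- \<nu> E) \<le> emeasure (neg_variation S \<nu>) E"
  unfolding neg_variation_def
  using pos_variation_ge[OF signed_measure_on_uminus] assms by blast

text \<open>For a competitor \<open>F\<close> one has
  \<open>\<nu> F = \<nu> E - \<nu> (E - F)\<close>, and the negative variation of \<open>E\<close>
  dominates \<open>- \<nu> (E - F)\<close>. Taking the supremum over \<open>F\<close> needs no set
  that attains it.\<close>

lemma pos_variation_le_neg_variation_add: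
  assumes \<nu>: "signed_measure_on S \<nu>" and E: "E \<in> sets (restrict_space borel S)"
    and fin: "finite_measure (neg_variation S \<nu>)"
  shows "emeasure (pos_variation S \<nu>) E \<le> ennreal (measure (neg_variation S \<nu>) E + \<nu> E)"
  unfolding emeasure_pos_variation[OF \<nu> E]
proof (rule SUP_least, clarify)
  interpret N: finite_measure "neg_variation S \<nu>" by fact
  fix F assume F: "F \<in> sets (restrict_space borel S)" "F \<subseteq> E"
  have "\<nu> (F \<union> (E - F)) = \<nu> F + \<nu> (E - F)"
    using F E by (intro signed_measure_on_Un[OF \<nu>]) auto
  moreover have "F \<union> (E - F) = E" using F by blast
  moreover have "- \<nu> (E - F) \<le> measure (neg_variation S \<nu>) (E - F)"
    using neg_variation_ge[OF \<nu>, of "E - F"] F E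
    by (simp add: N.emeasure_eq_measure ennreal_le_iff sets.Diff)
  moreover have "measure (neg_variation S \<nu>) (E - F) \<le> measure (neg_variation S \<nu>) E"
    using E by (intro N.finite_measure_mono) auto
  ultimately show "ennreal (\<nu> F) \<le> ennreal (measure (neg_variation S \<nu>) E + \<nu> E)"
    by (intro ennreal_leI) simp
qed

text \<open>The previous bound gives one inequality. Applied to \<open>- \<nu>\<close>, which
  exchanges the two variations, it gives the other.\<close>

lemma measure_pos_variation_diff:
  assumes \<nu>: "signed_measure_on S \<nu>" and E: "E \<in> sets (restrict_space borel S)"
    and fin: "finite_measure (pos_variation S \<nu>)" "finite_measure (neg_variation S \<nu>)"
  shows "measure (pos_variation S \<nu>) E - measure (neg_variation S \<nu>) E = \<nu> E"
proof (rule antisym)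
  have le: "measure (pos_variation S \<xi>) E - measure (neg_variation S \<xi>) E \<le> \<xi> E"
    if \<xi>: "signed_measure_on S \<xi>" "finite_measure (pos_variation S \<xi>)"
      "finite_measure (neg_variation S \<xi>)" for \<xi>
  proof -
    interpret P: finite_measure "pos_variation S \<xi>" by fact
    interpret N: finite_measure "neg_variation S \<xi>" by fact
    \<comment> \<open>This makes \<open>measure (neg_variation S \<xi>) E + \<xi> E\<close>
      nonnegative, so the bound under \<open>ennreal\<close> can be read as one between
      reals.\<close>
    have "- \<xi> E \<le> measure (neg_variation S \<xi>) E"
      using neg_variation_ge[OF \<xi>(1) E] by (simp add: N.emeasure_eq_measure)
    then show ?thesis
      using pos_variation_le_neg_variation_add[OF \<xi>(1) E \<xi>(3)]
      by (simp add: P.emeasure_eq_measure)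
  qed
  show "measure (pos_variation S \<nu>) E - measure (neg_variation S \<nu>) E \<le> \<nu> E"
    using le \<nu> fin by blast
  show "\<nu> E \<le> measure (pos_variation S \<nu>) E - measure (neg_variation S \<nu>) E"
    using le[of "\<lambda>A. - \<nu> A"] signed_measure_on_uminus[OF \<nu>] fin
    by (simp add: neg_variation_def)
qed

section \<open>Integrals with respect to differences of measures\<close>

text \<open>Induction over measurable functions: the hypothesis is the case of indicators. Sums of
  integrals are compared because differences could be of the form infinity minus infinity.\<close>

lemma nn_integral_add_cong:
  assumes sets: "sets B = sets A" "sets C = sets A" "sets D = sets A"
    and eq: "\<And>E. E \<in> sets A \<Longrightarrow> emeasure A E + emeasure B E = emeasure C E + emeasure D E"
    and f: "f \<in> borel_measurable A"
  shows "nn_integral A f + nn_integral B f = nn_integral C f + nn_integral D f"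
  using f
proof induction
  case (cong f g)
  have "space B = space A" "space C = space A" "space D = space A"
    using sets by (auto dest: sets_eq_imp_space_eq)
  then have "nn_integral M f = nn_integral M g" if "M \<in> {A, B, C, D}" for M
    using that cong(3) by (intro nn_integral_cong) auto
  then show ?case using cong by simp
next
  case (set E)
  then show ?case using eq sets by simp
next
  case (mult u c)
  have "u \<in> borel_measurable M" if "M \<in> {A, B, C, D}" for M
    using that mult(2) sets by (auto cong: measurable_cong_sets)
  with mult show ?case by (simp add: nn_integral_cmult flip: distrib_left)
next
  case (add u v)
  have "u \<in> borel_measurable M" "v \<in> borel_measurable M" if "M \<in> {A, B, C, D}" for M
    using that add(1,3) sets by (auto cong: measurable_cong_sets)
  then have "nn_integral M (\<lambda>x. v x + u x) = nn_integral M v + nn_integral M u"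
    if "M \<in> {A, B, C, D}" for M
    using that by (intro nn_integral_add) auto
  \<comment> \<open>Regroups the four integrals so that the hypotheses for \<open>u\<close> and
    \<open>v\<close> apply separately.\<close>
  moreover have swap: "(a + b) + (c + d) = (a + c) + (b + d)" for a b c d :: ennreal
    by (simp add: ac_simps)
  ultimately show ?case using add.IH by (simp, subst (1 2) swap) simp
next
  case (seq U)
  have "U i \<in> borel_measurable M" if "M \<in> {A, B, C, D}" for M i
    using that seq(1) sets by (auto cong: measurable_cong_sets)
  then have "(\<integral>\<^sup>+x. (SUP i. U i x) \<partial>M) = (SUP i. nn_integral M (U i))"
    if "M \<in> {A, B, C, D}" for M
    using that \<open>incseq U\<close> by (intro nn_integral_monotone_convergence_SUP) auto
  moreover have "(SUP i. U i) = (\<lambda>x. SUP i. U i x)" by (simp add: fun_eq_iff image_comp)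
  ultimately have sup: "nn_integral M (SUP i. U i) = (SUP i. nn_integral M (U i))"
    if "M \<in> {A, B, C, D}" for M
    using that by metis
  \<comment> \<open>For increasing sequences the sum of the suprema is the supremum of the sums,
    which reduces the limit case to the induction hypothesis.\<close>
  have inc: "incseq (\<lambda>i. nn_integral M (U i))" for M
    using \<open>incseq U\<close> by (auto simp: incseq_def le_fun_def intro!: nn_integral_mono)
  show ?case
    using seq.IH by (simp add: sup ennreal_SUP_add[OF inc inc, symmetric] del: Sup_apply SUP_apply)
qed

lemma integral_diff_cong:
  fixes f :: "'a \<Rightarrow> real"
  assumes "finite_measure A" "finite_measure B" "finite_measure C" "finite_measure D"
    and sets: "sets B = sets A" "sets C = sets A" "sets D = sets A"
    and eq: "\<And>E. E \<in> sets A \<Longrightarrow> measure A E - measure B E = measure C E - measure D E"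
    and int: "integrable A f" "integrable B f" "integrable C f" "integrable D f"
  shows "integral\<^sup>L A f - integral\<^sup>L B f = integral\<^sup>L C f - integral\<^sup>L D f"
proof -
  interpret A: finite_measure A by fact
  interpret B: finite_measure B by fact
  interpret C: finite_measure C by fact
  interpret D: finite_measure D by fact
  \<comment> \<open>The subtracted measures change sides, turning the identity of differences into
    one of sums.\<close>
  have eq': "emeasure A E + emeasure D E = emeasure C E + emeasure B E" if "E \<in> sets A" for E
    using eq[OF that]
    by (simp add: A.emeasure_eq_measure B.emeasure_eq_measure C.emeasure_eq_measure
        D.emeasure_eq_measure flip: ennreal_plus)
  \<comment> \<open>Used for both \<open>f\<close> and \<open>- f\<close>: truncation under the
    nonnegative integral turns these into the positive and negative parts of
    \<open>f\<close>.\<close>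
  have "enn2real (\<integral>\<^sup>+x. g x \<partial>A) - enn2real (\<integral>\<^sup>+x. g x \<partial>B) =
      enn2real (\<integral>\<^sup>+x. g x \<partial>C) - enn2real (\<integral>\<^sup>+x. g x \<partial>D)"
    if g: "integrable A g" "integrable B g" "integrable C g" "integrable D g" for g :: "'a \<Rightarrow> real"
  proof -
    have fin: "(\<integral>\<^sup>+x. g x \<partial>M) < top" if "M \<in> {A, B, C, D}" for M
    proof -
      have "(\<integral>\<^sup>+x. g x \<partial>M) \<le> (\<integral>\<^sup>+x. norm (g x) \<partial>M)"
        by (intro nn_integral_mono ennreal_leI) simp
      also have "\<dots> < top" using g that by (auto simp: integrable_iff_bounded)
      finally show ?thesis .
    qed
    have "(\<integral>\<^sup>+x. g x \<partial>A) + (\<integral>\<^sup>+x. g x \<partial>D) = (\<integral>\<^sup>+x. g x \<partial>C) + (\<integral>\<^sup>+x. g x \<partial>B)"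
      using sets eq' g by (intro nn_integral_add_cong) auto
    then have "enn2real (\<integral>\<^sup>+x. g x \<partial>A) + enn2real (\<integral>\<^sup>+x. g x \<partial>D) =
        enn2real (\<integral>\<^sup>+x. g x \<partial>C) + enn2real (\<integral>\<^sup>+x. g x \<partial>B)"
      using fin by (simp flip: enn2real_plus)
    then show ?thesis by simp
  qed
  from this[OF int] this[of "\<lambda>x. - f x"] int show ?thesis
    by (simp add: real_lebesgue_integral_def)
qed

section \<open>Radon measures and push-forwards\<close>

text \<open>Finite Borel measures on a Polish space are inner regular. Extending \<open>M\<close> by
  zero outside \<open>S\<close> transfers this to the subspace.\<close>

lemma finite_measure_imp_radon:
  fixes S :: "'a::polish_space set"
  assumes "finite_measure M" and M: "sets M = sets (restrict_space borel S)"
    and S: "S \<in> sets borel"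
  shows "radon_measure_on S M"
proof -
  interpret M: finite_measure M by fact
  have space: "space M = S" using sets_eq_imp_space_eq[OF M] by (simp add: space_restrict_space)
  have id: "(\<lambda>x. x) \<in> measurable M borel"
    unfolding measurable_cong_sets[OF M refl] by (intro measurable_restrict_space1) simp
  \<comment> \<open>The push-forward under the inclusion of \<open>S\<close>; it agrees with
    \<open>M\<close> on Borel subsets of \<open>S\<close>, in particular on compact ones.\<close>
  define N where "N = distr M borel (\<lambda>x. x)"
  have N: "emeasure N B = emeasure M B" if "B \<in> sets borel" "B \<subseteq> S" for B
  proof -
    have "B \<inter> S = B" using that by blast
    then show ?thesis using that by (simp add: N_def emeasure_distr[OF id] space)
  qed
  have "emeasure M B = (SUP K \<in> {K. compact K \<and> K \<subseteq> B}. emeasure M K)" if "B \<in> sets M" for B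
  proof -
    have B: "B \<in> sets borel" "B \<subseteq> S"
      using that S by (auto simp: M sets_restrict_space_iff)
    have "emeasure N B = (SUP K \<in> {K. K \<subseteq> B \<and> compact K}. emeasure N K)"
      using B M.finite_measure_distr[OF id]
      by (intro inner_regular) (auto simp: N_def finite_measure.emeasure_finite)
    also have "\<dots> = (SUP K \<in> {K. compact K \<and> K \<subseteq> B}. emeasure M K)"
      using B by (intro SUP_cong) (auto simp: N borel_compact)
    finally show ?thesis using N B by simp
  qed
  then show ?thesis
    unfolding radon_measure_on_def using M M.emeasure_finite by (auto simp: less_top[symmetric])
qed

lemma radon_measure_on_compact_imp_finite:
  assumes "radon_measure_on S M" "compact S"
  shows "finite_measure M"
proof
  have "space M = S"
    using assms sets_eq_imp_space_eq[of M "restrict_space borel S"]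
    by (simp add: radon_measure_on_def space_restrict_space)
  then show "emeasure M (space M) \<noteq> \<infinity>"
    using assms by (auto simp: radon_measure_on_def)
qed

lemma integrable_continuous_on_compact:
  fixes f :: "'a::t2_space \<Rightarrow> real"
  assumes "finite_measure M" and M: "sets M = sets (restrict_space borel S)"
    and S: "compact S" and f: "continuous_on S f"
  shows "integrable M f"
proof -
  obtain C where C: "\<And>x. x \<in> S \<Longrightarrow> norm (f x) \<le> C"
    using compact_imp_bounded[OF compact_continuous_image[OF f S]]
    by (auto simp: bounded_iff)
  have "AE x in M. norm (f x) \<le> C"
    using C sets_eq_imp_space_eq[OF M] by (intro AE_I2) (simp add: space_restrict_space)
  moreover have "f \<in> borel_measurable M"
    using borel_measurable_continuous_on_restrict[OF f] M by (simp cong: measurable_cong_sets)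
  ultimately show ?thesis
    using assms(1) by (intro finite_measure.integrable_const_bound)
qed

text \<open>The variations of \<open>\<nu>'\<close> and the images of the variations of
  \<open>\<nu>\<close> are two pairs of finite measures, both with difference \<open>\<nu>'\<close>,
  so continuous functions have the same integral against either pair.\<close>

lemma signed_radon_push_forward:
  fixes S :: "'a::t2_space set" and T :: "'b::polish_space set"
    and \<nu> :: "'a set \<Rightarrow> real" and g :: "'a \<Rightarrow> 'b"
  defines "\<nu>' \<equiv> \<lambda>B. \<nu> (g -` B \<inter> S)"
  assumes \<nu>: "signed_radon_measure_on S \<nu>" and S: "compact S" and T: "compact T"
    and g: "g \<in> measurable (restrict_space borel S) (restrict_space borel T)"
  shows "signed_radon_measure_on T (\<nu>')"
    and "\<And>f. continuous_on T f \<Longrightarrow>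
      signed_integral T (\<nu>') f = signed_integral S \<nu> (\<lambda>x. f (g x))"
proof -
  let ?S = "restrict_space borel S" and ?T = "restrict_space borel T"
  let ?P = "pos_variation S \<nu>" and ?N = "neg_variation S \<nu>"
  let ?P' = "pos_variation T (\<nu>')" and ?N' = "neg_variation T (\<nu>')"
  have sm: "signed_measure_on S \<nu>" using \<nu> by (simp add: signed_radon_measure_on_def)
  have fin: "finite_measure ?P" "finite_measure ?N"
    using \<nu> S by (auto simp: signed_radon_measure_on_def
        intro: radon_measure_on_compact_imp_finite)
  have vimage: "g -` B \<inter> S \<in> sets ?S" if "B \<in> sets ?T" for B
    using measurable_sets[OF g that] by (simp add: space_restrict_space)
  have sm': "signed_measure_on T (\<nu>')"
    unfolding signed_measure_on_def
  proof (intro conjI allI impI)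
    show "\<nu>' {} = 0" using signed_measure_on_empty[OF sm] by (simp add: \<nu>'_def)
    fix A :: "nat \<Rightarrow> 'b set"
    assume A: "range A \<subseteq> sets ?T" "disjoint_family A"
    have "(\<lambda>i. \<nu> (g -` A i \<inter> S)) sums \<nu> (\<Union>i. g -` A i \<inter> S)"
      using A vimage by (intro signed_measure_on_sums[OF sm])
        (fastforce simp: disjoint_family_on_def)+
    moreover have "(\<Union>i. g -` A i \<inter> S) = g -` (\<Union>i. A i) \<inter> S" by blast
    ultimately show "(\<lambda>i. \<nu>' (A i)) sums \<nu>' (\<Union>i. A i)" by (simp add: \<nu>'_def)
  qed
  \<comment> \<open>Every value of the pushed-forward set function is a value of
    \<open>\<xi>\<close>, hence at most the total mass of its positive variation. Keeping
    \<open>\<xi>\<close> general covers \<open>\<nu>\<close> and \<open>- \<nu>\<close> at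
    once.\<close>
  have bound: "finite_measure (pos_variation T (\<lambda>B. \<xi> (g -` B \<inter> S)))"
    if \<xi>: "signed_measure_on S \<xi>" "finite_measure (pos_variation S \<xi>)"
      "signed_measure_on T (\<lambda>B. \<xi> (g -` B \<inter> S))" for \<xi>
  proof
    let ?\<xi>' = "\<lambda>B. \<xi> (g -` B \<inter> S)"
    interpret P: finite_measure "pos_variation S \<xi>" by fact
    have "T \<in> sets ?T" using sets.top[of ?T] by (simp add: space_restrict_space)
    moreover have "ennreal (?\<xi>' F) \<le> emeasure (pos_variation S \<xi>) (space (pos_variation S \<xi>))"
      if "F \<in> sets ?T" for F
      using pos_variation_ge[OF \<xi>(1) vimage[OF that]] emeasure_space order_trans by blast
    ultimately have "emeasure (pos_variation T ?\<xi>') (space (pos_variation T ?\<xi>'))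
        \<le> emeasure (pos_variation S \<xi>) (space (pos_variation S \<xi>))"
      by (auto simp: emeasure_pos_variation[OF \<xi>(3)] intro!: SUP_least)
    then show "emeasure (pos_variation T ?\<xi>') (space (pos_variation T ?\<xi>')) \<noteq> \<infinity>"
      using P.emeasure_finite by (metis infinity_ennreal_def top.extremum_unique)
  qed
  have fin': "finite_measure ?P'" "finite_measure ?N'"
    using bound[of \<nu>] bound[of "\<lambda>A. - \<nu> A"] sm sm' fin signed_measure_on_uminus[OF sm]
      signed_measure_on_uminus[OF sm'] by (simp_all add: \<nu>'_def neg_variation_def)
  have T': "T \<in> sets borel" using T by (rule borel_compact)
  show "signed_radon_measure_on T (\<nu>')"
    unfolding signed_radon_measure_on_def
    using sm' fin' T' by (auto intro!: finite_measure_imp_radon)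
  fix f :: "'b \<Rightarrow> real" assume f: "continuous_on T f"
  have fT: "f \<in> borel_measurable ?T" by (rule borel_measurable_continuous_on_restrict[OF f])
  have gP: "g \<in> measurable ?P ?T" and gN: "g \<in> measurable ?N ?T"
    using g by (simp_all cong: measurable_cong_sets)
  have int: "integrable M f" if "finite_measure M" "sets M = sets ?T" for M
    using integrable_continuous_on_compact[OF that T f] .
  have fin_distr: "finite_measure (distr ?P ?T g)" "finite_measure (distr ?N ?T g)"
    using fin gP gN by (auto intro: finite_measure.finite_measure_distr)
  have "integral\<^sup>L ?P' f - integral\<^sup>L ?N' f
      = integral\<^sup>L (distr ?P ?T g) f - integral\<^sup>L (distr ?N ?T g) f"
  proof (rule integral_diff_cong)
    fix E assume "E \<in> sets ?P'"
    then have E: "E \<in> sets ?T" by simp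
    have "measure (distr ?P ?T g) E - measure (distr ?N ?T g) E = \<nu> (g -` E \<inter> S)"
      using measure_pos_variation_diff[OF sm vimage[OF E] fin] E
      by (simp add: measure_distr gP gN)
    then show "measure ?P' E - measure ?N' E
        = measure (distr ?P ?T g) E - measure (distr ?N ?T g) E"
      using measure_pos_variation_diff[OF sm' E fin'] by (simp add: \<nu>'_def)
  qed (use fin' fin_distr int in auto)
  then show "signed_integral T (\<nu>') f = signed_integral S \<nu> (\<lambda>x. f (g x))"
    by (simp add: signed_integral_def integral_distr[OF gP fT] integral_distr[OF gN fT])
qed

section \<open>Linearity of the signed integral and compactness of the cube\<close>

lemma signed_integral_sum:
  assumes "signed_radon_measure_on S \<nu>" "compact S"
    and "\<And>i. i \<in> I \<Longrightarrow> continuous_on S (f i)"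
  shows "signed_integral S \<nu> (\<lambda>x. \<Sum>i\<in>I. c i * f i x) = (\<Sum>i\<in>I. c i * signed_integral S \<nu> (f i))"
proof -
  have int: "integrable M (f i)" if M: "radon_measure_on S M" and i: "i \<in> I" for M i
    using integrable_continuous_on_compact[OF radon_measure_on_compact_imp_finite[OF M assms(2)]
        _ assms(2) assms(3)[OF i]] M by (simp add: radon_measure_on_def)
  have "integral\<^sup>L M (\<lambda>x. \<Sum>i\<in>I. c i * f i x) = (\<Sum>i\<in>I. c i * integral\<^sup>L M (f i))"
    if "radon_measure_on S M" for M
    using int[OF that] by (simp add: Bochner_Integration.integral_sum)
  then show ?thesis
    using assms(1) unfolding signed_radon_measure_on_def signed_integral_def
    by (simp add: sum_subtractf right_diff_distrib)
qed

text \<open>Coordinates outside \<open>{1..n}\<close> range over the singleton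
  \<open>{undefined}\<close>, so the cube is a full product of compact sets and Tychonoff's theorem
  applies.\<close>

lemma compact_cube: "compact (cube n)"
proof -
  have "cube n = PiE UNIV (\<lambda>i. if i \<in> {1..n} then {0..1} else {undefined})"
    by (auto simp: cube_def PiE_def Pi_def extensional_def split: if_splits)
  moreover have "compactin (product_topology (\<lambda>i. euclidean) UNIV)
      (PiE UNIV (\<lambda>i::nat. if i \<in> {1..n} then {0..1::real} else {undefined}))"
    unfolding compactin_PiE by (auto simp: compactin_euclidean_iff)
  ultimately show ?thesis
    by (simp add: euclidean_product_topology compactin_euclidean_iff)
qed

section \<open>Hankel sequences\<close>

lemma incr_multi_index: "k \<in> multi_index n \<Longrightarrow> l \<in> {1..n} \<Longrightarrow> incr l k \<in> multi_index n"
  by (auto simp: multi_index_def incr_def PiE_iff extensional_def)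

lemma sum_incr:
  assumes "l \<in> {1..n}"
  shows "(\<Sum>i = 1..n. incr l k i) = (\<Sum>i = 1..n. k i) + 1"
proof -
  have "(\<Sum>i = 1..n. incr l k i) = (\<Sum>i = 1..n. k i + (if i = l then 1 else 0))"
    by (intro sum.cong) (auto simp: incr_def)
  then show ?thesis using assms by (simp add: sum.distrib)
qed

lemma hankel_incr_first:
  assumes "hankel n \<mu>" "k \<in> multi_index n" "1 \<le> l" "l \<le> n"
  shows "\<mu> (incr l k) = \<mu> (incr 1 k)"
  using assms(3,4)
proof (induction l rule: dec_induct)
  case (step l)
  then show ?case using assms(1,2) by (auto simp: hankel_def)
qed simp

text \<open>Units are moved one at a time from coordinates \<open>l \<ge> 2\<close> to coordinate
  \<open>1\<close>. The total degree is kept, while the weight on \<open>{2..n}\<close> drops and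
  serves as induction measure.\<close>

lemma hankel_eq_first:
  assumes "hankel n \<mu>" "n \<ge> 1" "k \<in> multi_index n"
  shows "\<mu> k = \<mu> (\<lambda>i\<in>{1..n}. if i = 1 then \<Sum>i = 1..n. k i else 0)"
  using assms(3)
proof (induction "\<Sum>i = 2..n. k i" arbitrary: k rule: less_induct)
  case less
  show ?case
  proof (cases "\<exists>l \<in> {2..n}. k l > 0")
    case False
    have "(\<Sum>i = 1..n. k i) = k 1 + (\<Sum>i = 2..n. k i)"
      using \<open>n \<ge> 1\<close> by (simp add: sum.atLeast_Suc_atMost numeral_2_eq_2)
    with False have "(\<Sum>i = 1..n. k i) = k 1" by simp
    with False less(2) have "k = (\<lambda>i\<in>{1..n}. if i = 1 then \<Sum>i = 1..n. k i else 0)"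
      by (fastforce simp: fun_eq_iff multi_index_def PiE_iff extensional_def restrict_def)
    then show ?thesis by simp
  next
    case True
    then obtain l where l: "l \<in> {2..n}" "k l > 0" by blast
    \<comment> \<open>One unit is removed at \<open>l\<close>: \<open>k\<close> is recovered as
      \<open>incr l j\<close>, and \<open>incr 1 j\<close> is \<open>k\<close> with that unit moved
      to coordinate \<open>1\<close>.\<close>
    define j where "j = k(l := k l - 1)"
    have j: "j \<in> multi_index n" and k: "k = incr l j"
      using less(2) l by (auto simp: j_def multi_index_def incr_def PiE_iff extensional_def)
    have "(\<Sum>i = 2..n. incr 1 j i) = (\<Sum>i = 2..n. j i)"
      by (intro sum.cong) (auto simp: incr_def)
    also have "\<dots> < (\<Sum>i = 2..n. k i)"
      using l by (intro sum_strict_mono_ex1) (auto simp: j_def)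
    finally have "\<mu> (incr 1 j) = \<mu> (\<lambda>i\<in>{1..n}. if i = 1 then \<Sum>i = 1..n. incr 1 j i else 0)"
      using j \<open>n \<ge> 1\<close> by (intro less(1) incr_multi_index) auto
    moreover have "(\<Sum>i = 1..n. incr 1 j i) = (\<Sum>i = 1..n. k i)"
      using l by (simp add: k sum_incr del: One_nat_def)
    moreover have "\<mu> k = \<mu> (incr 1 j)"
      using hankel_incr_first[OF assms(1) j, of l] l by (simp add: k)
    ultimately show ?thesis by (simp del: One_nat_def cong: if_cong)
  qed
qed

section \<open>The two implications\<close>

lemma prod_poly_expand:
  fixes p :: "nat \<Rightarrow> real poly"
  shows "(\<Prod>i = 1..n. poly (p i) t) = (\<Sum>k \<in> Pi\<^sub>E {1..n} (\<lambda>i. {..degree (p i)}).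
    (\<Prod>i = 1..n. coeff (p i) (k i)) * t ^ (\<Sum>i = 1..n. k i))"
  by (simp add: poly_altdef prod_sum_PiE prod.distrib power_sum)

text \<open>On monomials the representing integral sees only the total degree, which
  \<open>incr l\<close> and \<open>incr (l + 1)\<close> raise equally.\<close>

lemma strong_multilinear_imp_hankel:
  assumes "solves_strong_multilinear_hausdorff n \<mu>"
  shows "hankel n \<mu>"
  unfolding hankel_def
proof (intro ballI)
  obtain \<sigma> where \<sigma>: "\<And>p. functional_of n \<mu> p = signed_integral {0..1} \<sigma> (\<lambda>t. \<Prod>i = 1..n. poly (p i) t)"
    using assms by (auto simp: solves_strong_multilinear_hausdorff_def)
  have \<mu>: "\<mu> k = signed_integral {0..1} \<sigma> (\<lambda>t. t ^ (\<Sum>i = 1..n. k i))" if "k \<in> multi_index n" for k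
    using functional_of_monom[OF that, of \<mu>] \<sigma> by (simp add: poly_monom power_sum)
  fix k l assume "k \<in> multi_index n" "l \<in> {1..<n}"
  then show "\<mu> (incr l k) = \<mu> (incr (l + 1) k)"
    by (simp add: \<mu> incr_multi_index sum_incr del: One_nat_def)
qed

lemma hankel_imp_strong_multilinear:
  assumes n: "n \<ge> 1" and "solves_hausdorff n \<mu>" and hankel: "hankel n \<mu>"
  shows "solves_strong_multilinear_hausdorff n \<mu>"
proof -
  obtain \<nu> where \<nu>: "signed_radon_measure_on (cube n) \<nu>"
    and mom: "\<And>k. k \<in> multi_index n \<Longrightarrow>
      \<mu> k = signed_integral (cube n) \<nu> (\<lambda>t. \<Prod>i = 1..n. t i ^ k i)"
    using assms(2) by (auto simp: solves_hausdorff_def)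
  \<comment> \<open>Since \<open>n \<ge> 1\<close>, coordinate \<open>1\<close> is a genuine one and
    the projection maps the cube into \<open>[0,1]\<close>.\<close>
  have g: "(\<lambda>t. t 1) \<in> measurable (restrict_space borel (cube n)) (restrict_space borel {0..1::real})"
    using n by (intro measurable_restrict_space3 borel_measurable_continuous_onI)
      (auto simp: cube_def PiE_iff)
  define \<sigma> where "\<sigma> = (\<lambda>B. \<nu> ((\<lambda>t. t 1) -` B \<inter> cube n))"
  note push = signed_radon_push_forward[OF \<nu> compact_cube compact_Icc g, folded \<sigma>_def]
  have \<mu>: "\<mu> k = signed_integral {0..1} \<sigma> (\<lambda>t. t ^ (\<Sum>i = 1..n. k i))"
    if k: "k \<in> multi_index n" for k
  proof -
    let ?m = "\<Sum>i = 1..n. k i"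
    \<comment> \<open>The multi-index with the whole degree of \<open>k\<close> at coordinate
      \<open>1\<close>: its moment integrates a function of \<open>t 1\<close> alone, which the
      push-forward can represent.\<close>
    let ?e = "\<lambda>i\<in>{1..n}. if i = 1 then ?m else 0"
    have "(\<Prod>i = 1..n. t i ^ ?e i) = t 1 ^ ?m" for t :: "nat \<Rightarrow> real"
    proof -
      have "(\<Prod>i = 1..n. t i ^ ?e i) = (\<Prod>i = 1..n. if i = 1 then t i ^ ?m else 1)"
        by (intro prod.cong) auto
      then show ?thesis using n by simp
    qed
    moreover have "?e \<in> multi_index n" by (simp add: multi_index_def)
    ultimately have "\<mu> ?e = signed_integral (cube n) \<nu> (\<lambda>t. t 1 ^ ?m)"
      using mom[of ?e] by simp
    also have "\<dots> = signed_integral {0..1} \<sigma> (\<lambda>t. t ^ ?m)"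
      by (rule push(2)[symmetric]) (intro continuous_intros)
    finally show ?thesis using hankel_eq_first[OF hankel n k] by simp
  qed
  have "functional_of n \<mu> p = signed_integral {0..1} \<sigma> (\<lambda>t. \<Prod>i = 1..n. poly (p i) t)" for p
  proof -
    have "functional_of n \<mu> p = (\<Sum>k \<in> Pi\<^sub>E {1..n} (\<lambda>i. {..degree (p i)}).
        (\<Prod>i = 1..n. coeff (p i) (k i)) * signed_integral {0..1} \<sigma> (\<lambda>t. t ^ (\<Sum>i = 1..n. k i)))"
      unfolding functional_of_def
      by (intro sum.cong) (auto simp: \<mu> multi_index_def PiE_iff)
    \<comment> \<open>The product of polynomials expands over the same index set and with the same
      coefficients as \<open>functional_of\<close>, so linearity of the integral suffices.\<close>
    also have "\<dots> = signed_integral {0..1} \<sigma> (\<lambda>t. \<Prod>i = 1..n. poly (p i) t)"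
      unfolding prod_poly_expand
      by (rule signed_integral_sum[OF push(1), symmetric]) (auto intro!: continuous_intros)
    finally show ?thesis .
  qed
  with push(1) show ?thesis by (auto simp: solves_strong_multilinear_hausdorff_def)
qed

theorem theorem3p1:
  fixes n :: nat and \<mu> :: "(nat \<Rightarrow> nat) \<Rightarrow> real"
  assumes "n \<ge> 1"
    and "solves_hausdorff n \<mu>"
  shows "solves_strong_multilinear_hausdorff n \<mu> \<longleftrightarrow> hankel n \<mu>"
  using strong_multilinear_imp_hankel hankel_imp_strong_multilinear assms by blast

end
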